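(* Let $H=(V,E,w)$ be a hypergraph of rank $r$ with nonnegative hyperedge weights, let $f\ge 1$, $\mu\ge 1$ and $\alpha\ge 0$. Let $S_1$ be an $f$-edge-fault-tolerant multiplicative $\mu$-hyperspanner of $H$ and let $S_2$ be a (fault-free) additive hyperspanner of $H$ with surplus $\alpha$. Then $S=S_1\cup S_2$ (the sub-hypergraph whose hyperedge set is the union of those of $S_1$ and $S_2$), which has size $|S_1\cup S_2|$, satisfies: for all $s,t\in V$ and every $F\subseteq E$ with $|F|\le f$, $$\delta_{S\setminus F}(s,t)\le \delta_{H\setminus F}(s,t)+fr\big(2\alpha+(\mu-1)W_{s,t}\big)+\alpha,$$ where $W_{s,t}$ is the maximum hyperedge weight on a shortest $s$–$t$ path in $H\setminus F$.
   Context: The rank of a hypergraph is the maximum hyperedge size. A path between $u$ and $v$ is a sequence of vertices $u=x_0,\dots,x_\ell=v$ with hyperedges $h_1,\dots,h_\ell$ such that $x_{j-1},x_j\in h_j$; its length is $\sum_j w(h_j)$, and $\delta_H(u,v)$ is the minimum length of a $u$–$v$ path in $H$. For $F\subseteq E$, $H\setminus F$ has hyperedge set $E\setminus F$. A sub-hypergraph $S=(V,E')$, $E'\subseteq E$, is an $f$-EFT multiplicative $\mu$-hyperspanner of $H$ if $\delta_{S\setminus F}(u,v)\le \mu\,\delta_{H\setminus F}(u,v)$ for all $u,v\in V$ and all $F\subseteq E$ with $|F|\le f$; it is an additive hyperspanner with surplus $\alpha$ if $\delta_{S}(u,v)\le \delta_{H}(u,v)+\alpha$ for all $u,v\in V$.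 *)

theory Defs
  imports Complex_Main "HOL-Library.Extended_Real"
begin

record 'a hypergraph =
  verts :: "'a set"
  hedges :: "'a set set"
  weight :: "'a set \<Rightarrow> real"

definition hypergraph :: "'a hypergraph \<Rightarrow> bool" where
  "hypergraph H \<longleftrightarrow> finite (verts H) \<and> hedges H \<subseteq> Pow (verts H)"

definition nonneg_weights :: "'a hypergraph \<Rightarrow> bool" where
  "nonneg_weights H \<longleftrightarrow> (\<forall>h\<in>hedges H. 0 \<le> weight H h)"

text \<open>The inserted 0 only matters for a hypergraph without hyperedges.\<close>

definition hrank :: "'a hypergraph \<Rightarrow> nat" where
  "hrank H = Max (insert 0 (card ` hedges H))"

definition hsize :: "'a hypergraph \<Rightarrow> nat" where
  "hsize H = card (hedges H)"

definition delete_hedges :: "'a hypergraph \<Rightarrow> 'a set set \<Rightarrow> 'a hypergraph" (infixl "\<setminus>" 65) where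
  "H \<setminus> F = H\<lparr>hedges := hedges H - F\<rparr>"

definition sub_hypergraph :: "'a hypergraph \<Rightarrow> 'a hypergraph \<Rightarrow> bool" where
  "sub_hypergraph S H \<longleftrightarrow> verts S = verts H \<and> hedges S \<subseteq> hedges H \<and> weight S = weight H"

text \<open>Meant for two sub-hypergraphs of one hypergraph, which have the same weight function;
  hence taking the weights of the first argument loses nothing.\<close>

definition hunion :: "'a hypergraph \<Rightarrow> 'a hypergraph \<Rightarrow> 'a hypergraph" (infixl "\<squnion>\<^sub>h" 65) where
  "S1 \<squnion>\<^sub>h S2 = \<lparr>verts = verts S1 \<union> verts S2, hedges = hedges S1 \<union> hedges S2, weight = weight S1\<rparr>"

text \<open>A path is a vertex sequence together with the sequence of hyperedges it uses; neither
  has to be repetition-free.\<close>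

definition is_path :: "'a hypergraph \<Rightarrow> 'a \<Rightarrow> 'a list \<Rightarrow> 'a set list \<Rightarrow> 'a \<Rightarrow> bool" where
  "is_path H u xs hs v \<longleftrightarrow>
     length xs = Suc (length hs) \<and> set xs \<subseteq> verts H \<and> set hs \<subseteq> hedges H \<and>
     xs ! 0 = u \<and> xs ! length hs = v \<and>
     (\<forall>j<length hs. xs ! j \<in> hs ! j \<and> xs ! Suc j \<in> hs ! j)"

definition path_length :: "'a hypergraph \<Rightarrow> 'a set list \<Rightarrow> real" where
  "path_length H hs = (\<Sum>h\<leftarrow>hs. weight H h)"

text \<open>The value is \<open>\<infinity>\<close> if there is no path from \<open>u\<close> to \<open>v\<close>. In a finite hypergraph with
  nonnegative weights the infimum is a minimum whenever there is a path.\<close>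

definition hdist :: "'a hypergraph \<Rightarrow> 'a \<Rightarrow> 'a \<Rightarrow> ereal" ("\<delta>") where
  "\<delta> H u v = (INF (xs, hs) \<in> {(xs, hs). is_path H u xs hs v}. ereal (path_length H hs))"

definition is_shortest_path :: "'a hypergraph \<Rightarrow> 'a \<Rightarrow> 'a list \<Rightarrow> 'a set list \<Rightarrow> 'a \<Rightarrow> bool" where
  "is_shortest_path H u xs hs v \<longleftrightarrow>
     is_path H u xs hs v \<and> ereal (path_length H hs) = \<delta> H u v"

text \<open>Weights being nonnegative, the inserted 0 only matters for a path without hyperedges.\<close>

definition max_weight :: "'a hypergraph \<Rightarrow> 'a set list \<Rightarrow> real" where
  "max_weight H hs = Max (insert 0 (weight H ` set hs))"

definition eft_mult_hyperspanner ::
    "nat \<Rightarrow> real \<Rightarrow> 'a hypergraph \<Rightarrow> 'a hypergraph \<Rightarrow> bool" where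
  "eft_mult_hyperspanner f \<mu> H S \<longleftrightarrow> sub_hypergraph S H \<and>
     (\<forall>u\<in>verts H. \<forall>v\<in>verts H. \<forall>F. F \<subseteq> hedges H \<and> card F \<le> f \<longrightarrow>
        \<delta> (S \<setminus> F) u v \<le> ereal \<mu> * \<delta> (H \<setminus> F) u v)"

definition additive_hyperspanner ::
    "real \<Rightarrow> 'a hypergraph \<Rightarrow> 'a hypergraph \<Rightarrow> bool" where
  "additive_hyperspanner \<alpha> H S \<longleftrightarrow> sub_hypergraph S H \<and>
     (\<forall>u\<in>verts H. \<forall>v\<in>verts H. \<delta> S u v \<le> \<delta> H u v + ereal \<alpha>)"

end

theory Submission imports Defs begin

text \<open>Call two vertices separated if deleting \<open>F\<close> increases their distance in \<open>S2\<close>. Walk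
  greedily along the given path: from the current vertex jump, inside \<open>S2 \<setminus> F\<close>, to the last vertex
  of the path not separated from it, at an extra cost of \<open>\<alpha>\<close>, and then cross one hyperedge inside
  \<open>S1 \<setminus> F\<close>, at an extra cost of at most \<open>(\<mu> - 1) W\<close>. The starting vertices of the jumps are pairwise
  separated. If \<open>x\<close> and \<open>y\<close> are separated, an almost shortest path of \<open>S2\<close> between them meets \<open>F\<close>,
  so the distances of \<open>x\<close> and of \<open>y\<close> to the nearest vertex of \<open>\<Union>F\<close> in \<open>S2 \<setminus> F\<close> add up to less than
  the distance of \<open>x\<close> and \<open>y\<close> in \<open>S2 \<setminus> F\<close>; hence these nearest vertices differ. So there are at most
  \<open>card (\<Union>F) + 1\<close> jumps, and \<open>card (\<Union>F) \<le> f r\<close>.\<close>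

section \<open>Walks: concatenation, reversal, monotonicity\<close>

text \<open>A path with its inner vertices forgotten: the length depends on the hyperedges only, and
  rule induction replaces indexing into two lists.\<close>

inductive walk :: "'a hypergraph \<Rightarrow> 'a \<Rightarrow> 'a set list \<Rightarrow> 'a \<Rightarrow> bool" for H where
  walk_Nil: "u \<in> verts H \<Longrightarrow> walk H u [] u"
| walk_Cons: "\<lbrakk>u \<in> verts H; h \<in> hedges H; u \<in> h; v \<in> h; walk H v hs w\<rbrakk> \<Longrightarrow> walk H u (h # hs) w"

lemma is_path_Cons:
  "is_path H u (x # xs) (h # hs) w \<longleftrightarrow>
     x = u \<and> u \<in> verts H \<and> h \<in> hedges H \<and> u \<in> h \<and> xs ! 0 \<in> h \<and> is_path H (xs ! 0) xs hs w"
  unfolding is_path_def by (auto simp: All_less_Suc2)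

lemma walk_iff_is_path: "walk H u hs v \<longleftrightarrow> (\<exists>xs. is_path H u xs hs v)"
proof
  assume "walk H u hs v"
  then show "\<exists>xs. is_path H u xs hs v"
  proof (induction rule: walk.induct)
    case (walk_Nil u)
    then have "is_path H u [u] [] u"
      by (auto simp: is_path_def)
    then show ?case ..
  next
    case (walk_Cons u h v hs w)
    then obtain xs where xs: "is_path H v xs hs w"
      by blast
    then have "xs ! 0 = v"
      by (auto simp: is_path_def)
    with xs walk_Cons have "is_path H u (u # xs) (h # hs) w"
      by (simp add: is_path_Cons)
    then show ?case ..
  qed
next
  assume "\<exists>xs. is_path H u xs hs v"
  then obtain xs where "is_path H u xs hs v" ..
  then show "walk H u hs v"
  proof (induction hs arbitrary: u xs)
    case Nil
    then show ?case
      by (cases xs) (auto simp: is_path_def intro: walk_Nil)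
  next
    case (Cons h hs)
    then obtain x xs' where xs: "xs = x # xs'"
      by (cases xs) (auto simp: is_path_def)
    with Cons.prems have "is_path H (xs' ! 0) xs' hs v"
      by (simp add: is_path_Cons)
    then have "walk H (xs' ! 0) hs v"
      by (rule Cons.IH)
    with Cons.prems xs show ?case
      by (auto simp: is_path_Cons intro: walk_Cons)
  qed
qed

lemma walk_verts: "walk H u hs v \<Longrightarrow> u \<in> verts H \<and> v \<in> verts H"
  by (induction rule: walk.induct) auto

lemma walk_hedges: "walk H u hs v \<Longrightarrow> set hs \<subseteq> hedges H"
  by (induction rule: walk.induct) auto

lemma walk_append: "walk H u hs v \<Longrightarrow> walk H v hs' w \<Longrightarrow> walk H u (hs @ hs') w"
  by (induction rule: walk.induct) (auto intro: walk.intros)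

lemma walk_single:
  "\<lbrakk>u \<in> verts H; v \<in> verts H; h \<in> hedges H; u \<in> h; v \<in> h\<rbrakk> \<Longrightarrow> walk H u [h] v"
  by (auto intro: walk.intros)

lemma walk_rev: "walk H u hs v \<Longrightarrow> walk H v (rev hs) u"
proof (induction rule: walk.induct)
  case (walk_Cons u h v hs w)
  then have "walk H v [h] u"
    by (auto intro: walk_single dest: walk_verts)
  with walk_Cons show ?case
    by (auto intro: walk_append)
qed (auto intro: walk_Nil)

lemma walk_mono:
  "walk H u hs v \<Longrightarrow> verts H \<subseteq> verts H' \<Longrightarrow> hedges H \<subseteq> hedges H' \<Longrightarrow> walk H' u hs v"
  by (induction rule: walk.induct) (auto intro: walk.intros)

section \<open>Lengths and distances\<close>

lemma path_length_Nil [simp]: "path_length H [] = 0"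
  and path_length_Cons [simp]: "path_length H (h # hs) = weight H h + path_length H hs"
  and path_length_append [simp]: "path_length H (hs @ hs') = path_length H hs + path_length H hs'"
  and path_length_rev [simp]: "path_length H (rev hs) = path_length H hs"
  by (simp_all add: path_length_def rev_map[symmetric])

lemma path_length_nonneg:
  "nonneg_weights H \<Longrightarrow> walk H u hs v \<Longrightarrow> 0 \<le> path_length H hs"
  by (auto simp: path_length_def nonneg_weights_def subset_iff
      intro!: sum_list_nonneg dest!: walk_hedges)

text \<open>Both infima range over the same set of values, so distances can be handled through walks
  alone.\<close>

lemma hdist_eq: "\<delta> H u v = (INF hs \<in> {hs. walk H u hs v}. ereal (path_length H hs))"
proof -
  have "(\<lambda>(xs, hs). ereal (path_length H hs)) ` {(xs, hs). is_path H u xs hs v}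
      = (\<lambda>hs. ereal (path_length H hs)) ` {hs. walk H u hs v}"
    by (force simp: walk_iff_is_path)
  then show ?thesis
    by (simp add: hdist_def)
qed

lemma hdist_le: "walk H u hs v \<Longrightarrow> \<delta> H u v \<le> ereal (path_length H hs)"
  unfolding hdist_eq by (auto intro: INF_lower2)

lemma hdist_greatest: "(\<And>hs. walk H u hs v \<Longrightarrow> c \<le> ereal (path_length H hs)) \<Longrightarrow> c \<le> \<delta> H u v"
  unfolding hdist_eq by (auto intro: INF_greatest)

text \<open>A strict bound yields a concrete walk, which avoids proving that the infimum is
  attained.\<close>

lemma hdist_less:
  assumes "\<delta> H u v < c"
  obtains hs where "walk H u hs v" "ereal (path_length H hs) < c"
  using assms unfolding hdist_eq INF_less_iff by blast

lemma hdist_nonneg: "nonneg_weights H \<Longrightarrow> 0 \<le> \<delta> H u v"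
  by (rule hdist_greatest) (simp add: path_length_nonneg)

lemma hdist_refl: "u \<in> verts H \<Longrightarrow> \<delta> H u u \<le> 0"
  using hdist_le[OF walk_Nil] by (simp add: zero_ereal_def)

lemma hdist_commute: "\<delta> H u v = \<delta> H v u"
  by (rule antisym; rule hdist_greatest; drule walk_rev; drule hdist_le; simp)

text \<open>Every walk from \<open>v\<close> to \<open>w\<close> extends the given walk. The length
  of the given walk is a real number, so it can be moved to the left, leaving a lower bound for an
  infimum.\<close>

lemma hdist_triangle_walk:
  assumes "walk H u hs v"
  shows "\<delta> H u w \<le> ereal (path_length H hs) + \<delta> H v w"
proof -
  have "\<delta> H u w - ereal (path_length H hs) \<le> \<delta> H v w"
  proof (rule hdist_greatest)
    fix hs' assume "walk H v hs' w"
    with assms have "\<delta> H u w \<le> ereal (path_length H (hs @ hs'))"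
      by (intro hdist_le walk_append)
    then show "\<delta> H u w - ereal (path_length H hs) \<le> ereal (path_length H hs')"
      by (cases "\<delta> H u w") auto
  qed
  then show ?thesis
    by (cases "\<delta> H u w"; cases "\<delta> H v w") auto
qed

text \<open>The version for a fixed first leg is minimised over that leg as well. Nonnegativity
  excludes -\<infinity>, so a second leg that is not infinite is a real number and can be
  subtracted.\<close>

lemma hdist_triangle:
  assumes "nonneg_weights H"
  shows "\<delta> H u w \<le> \<delta> H u v + \<delta> H v w"
proof (cases "\<delta> H v w = \<infinity>")
  case True
  then show ?thesis
    using hdist_nonneg[OF assms, of u v] by auto
next
  case False
  then obtain d where d: "\<delta> H v w = ereal d"
    using hdist_nonneg[OF assms, of v w] by (cases "\<delta> H v w") auto
  have "\<delta> H u w - ereal d \<le> \<delta> H u v"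
  proof (rule hdist_greatest)
    fix hs assume "walk H u hs v"
    from hdist_triangle_walk[OF this, of w] show "\<delta> H u w - ereal d \<le> ereal (path_length H hs)"
      by (cases "\<delta> H u w") (auto simp: d)
  qed
  then show ?thesis
    by (cases "\<delta> H u w"; cases "\<delta> H u v") (auto simp: d)
qed

lemma hdist_antimono:
  assumes "verts H \<subseteq> verts H'" "hedges H \<subseteq> hedges H'" "weight H = weight H'"
  shows "\<delta> H' u v \<le> \<delta> H u v"
proof (rule hdist_greatest)
  fix hs assume "walk H u hs v"
  then have "\<delta> H' u v \<le> ereal (path_length H' hs)"
    using assms by (auto intro: hdist_le walk_mono)
  then show "\<delta> H' u v \<le> ereal (path_length H hs)"
    using assms by (simp add: path_length_def)
qed

section \<open>Deletion, union and sub-hypergraphs\<close>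

lemma delete_hedges_simps [simp]:
  "verts (H \<setminus> F) = verts H" "hedges (H \<setminus> F) = hedges H - F" "weight (H \<setminus> F) = weight H"
  "path_length (H \<setminus> F) = path_length H"
  by (auto simp: delete_hedges_def path_length_def fun_eq_iff)

lemma hunion_simps [simp]:
  "verts (S1 \<squnion>\<^sub>h S2) = verts S1 \<union> verts S2" "hedges (S1 \<squnion>\<^sub>h S2) = hedges S1 \<union> hedges S2"
  "weight (S1 \<squnion>\<^sub>h S2) = weight S1"
  by (auto simp: hunion_def)

lemma nonneg_weights_delete: "nonneg_weights H \<Longrightarrow> nonneg_weights (H \<setminus> F)"
  by (auto simp: nonneg_weights_def)

lemma nonneg_weights_sub: "nonneg_weights H \<Longrightarrow> sub_hypergraph S H \<Longrightarrow> nonneg_weights S"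
  by (auto simp: nonneg_weights_def sub_hypergraph_def)

section \<open>Faulty vertices and separated pairs\<close>

text \<open>If the walk uses \<open>F\<close>, take for \<open>z\<close> the vertex where it enters
  its first hyperedge of \<open>F\<close> and for \<open>z'\<close> the vertex where it leaves its
  last one. The portions before \<open>z\<close> and after \<open>z'\<close> avoid \<open>F\<close>,
  and the omitted middle has nonnegative length.\<close>

lemma walk_avoids_or_meets:
  assumes "walk S x hs y" and nonneg: "nonneg_weights S"
  shows "walk (S \<setminus> F) x hs y \<or>
    (\<exists>z\<in>\<Union>F. \<exists>z'\<in>\<Union>F. \<delta> (S \<setminus> F) x z + \<delta> (S \<setminus> F) z' y \<le> ereal (path_length S hs))"
  using assms(1)
proof (induction rule: walk.induct)
  case (walk_Nil u)
  then show ?case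
    by (auto intro: walk.walk_Nil)
next
  case (walk_Cons u h v hs w)
  note nn = nonneg_weights_delete[OF nonneg, of F]
  have wh: "0 \<le> weight S h"
    using nonneg walk_Cons by (auto simp: nonneg_weights_def)
  have v: "v \<in> verts S"
    using walk_verts[OF walk_Cons.hyps(5)] by simp
  show ?case
  proof (cases "h \<in> F")
    case True
    \<comment> \<open>As \<open>u\<close> lies in the faulty \<open>h\<close>, it serves as
      \<open>z\<close> at distance 0. Only \<open>z'\<close> is missing: it is \<open>v\<close> if
      the rest avoids \<open>F\<close>, and otherwise comes from the induction hypothesis, whose own
      \<open>z\<close> is dropped.\<close>
    have "\<exists>z'\<in>\<Union>F. \<delta> (S \<setminus> F) z' w \<le> ereal (path_length S hs)"
      using walk_Cons.IH
    proof
      assume "walk (S \<setminus> F) v hs w"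
      then have "\<delta> (S \<setminus> F) v w \<le> ereal (path_length S hs)"
        using hdist_le by fastforce
      with True walk_Cons show ?thesis by blast
    next
      assume "\<exists>z\<in>\<Union>F. \<exists>z'\<in>\<Union>F. \<delta> (S \<setminus> F) v z + \<delta> (S \<setminus> F) z' w \<le> ereal (path_length S hs)"
      then obtain z z' where z: "z' \<in> \<Union>F"
        and le: "\<delta> (S \<setminus> F) v z + \<delta> (S \<setminus> F) z' w \<le> ereal (path_length S hs)"
        by blast
      have "0 + \<delta> (S \<setminus> F) z' w \<le> \<delta> (S \<setminus> F) v z + \<delta> (S \<setminus> F) z' w"
        by (intro add_right_mono hdist_nonneg nn)
      with z le show ?thesis
        by (metis add_0 order_trans)
    qed
    then obtain z' where z': "z' \<in> \<Union>F" "\<delta> (S \<setminus> F) z' w \<le> ereal (path_length S hs)"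
      by blast
    have "\<delta> (S \<setminus> F) u u + \<delta> (S \<setminus> F) z' w \<le> 0 + ereal (path_length S hs)"
      using z' walk_Cons by (intro add_mono hdist_refl) auto
    also have "\<dots> \<le> ereal (path_length S (h # hs))"
      using wh by simp
    finally show ?thesis
      using True walk_Cons z' by blast
  next
    case False
    from walk_Cons.IH show ?thesis
    proof
      assume "walk (S \<setminus> F) v hs w"
      with False walk_Cons show ?thesis
        by (auto intro: walk.walk_Cons[where v = v])
    next
      assume "\<exists>z\<in>\<Union>F. \<exists>z'\<in>\<Union>F. \<delta> (S \<setminus> F) v z + \<delta> (S \<setminus> F) z' w \<le> ereal (path_length S hs)"
      then obtain z z' where z: "z \<in> \<Union>F" "z' \<in> \<Union>F"
        and le: "\<delta> (S \<setminus> F) v z + \<delta> (S \<setminus> F) z' w \<le> ereal (path_length S hs)"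
        by blast
      have "walk (S \<setminus> F) u [h] v"
        using False walk_Cons v by (intro walk_single) auto
      from hdist_triangle_walk[OF this, of z]
      have "\<delta> (S \<setminus> F) u z + \<delta> (S \<setminus> F) z' w
          \<le> (ereal (weight S h) + \<delta> (S \<setminus> F) v z) + \<delta> (S \<setminus> F) z' w"
        by (intro add_right_mono) simp
      also have "\<dots> \<le> ereal (weight S h) + ereal (path_length S hs)"
        unfolding add.assoc by (intro add_left_mono le)
      finally show ?thesis
        using z by auto
    qed
  qed
qed

definition separated :: "'a hypergraph \<Rightarrow> 'a set set \<Rightarrow> 'a \<Rightarrow> 'a \<Rightarrow> bool" where
  "separated S F x y \<longleftrightarrow> \<delta> S x y < \<delta> (S \<setminus> F) x y"

lemma separated_commute: "separated S F x y \<longleftrightarrow> separated S F y x"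
  by (simp add: separated_def hdist_commute)

lemma not_separated_refl: "nonneg_weights S \<Longrightarrow> x \<in> verts S \<Longrightarrow> \<not> separated S F x x"
  using hdist_refl[of x "S \<setminus> F"] hdist_nonneg[of S x x] by (auto simp: separated_def)

text \<open>A walk of \<open>S\<close> shorter than the distance in \<open>S \<setminus> F\<close>
  cannot survive the deletion, so it meets \<open>F\<close>. Both distances are measured towards
  \<Union>F, ready for comparison with nearest faulty vertices.\<close>

lemma separated_imp_faulty:
  assumes "nonneg_weights S" and "separated S F x y"
  obtains z z' where "z \<in> \<Union>F" "z' \<in> \<Union>F"
    "\<delta> (S \<setminus> F) x z + \<delta> (S \<setminus> F) y z' < \<delta> (S \<setminus> F) x y"
proof -
  from assms(2) obtain hs where hs: "walk S x hs y" "ereal (path_length S hs) < \<delta> (S \<setminus> F) x y"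
    unfolding separated_def by (rule hdist_less)
  then have "\<not> walk (S \<setminus> F) x hs y"
    using hdist_le by fastforce
  with walk_avoids_or_meets[OF hs(1) assms(1), of F] hs(2) that show ?thesis
    by (metis hdist_commute order_le_less_trans)
qed

text \<open>Sending each vertex of \<open>K\<close> to a nearest vertex of \<Union>F is injective:
  through a common nearest vertex, the triangle inequality would contradict
  \<open>separated_imp_faulty\<close>. The successor covers an empty \<Union>F, where no pair is
  separated and \<open>K\<close> may still be a singleton.\<close>

lemma card_separated_le:
  assumes nonneg: "nonneg_weights S" and fin: "finite (\<Union>F)"
    and sep: "\<And>x y. x \<in> K \<Longrightarrow> y \<in> K \<Longrightarrow> x \<noteq> y \<Longrightarrow> separated S F x y"
  shows "card K \<le> Suc (card (\<Union>F))"
proof (cases "\<Union>F = {}")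
  case True
  then have "x = y" if "x \<in> K" "y \<in> K" for x y
    using separated_imp_faulty[OF nonneg sep[OF that]] by blast
  then have "card K \<le> Suc 0"
    by (metis card_le_Suc0_iff_eq card.infinite le0)
  then show ?thesis by simp
next
  case False
  \<comment> \<open>All distances to \<Union>F may be \<infinity>, and then the choice is arbitrary.
    For a separated pair the strict inequality above forces finite minima.\<close>
  define near where "near x = arg_min_on (\<delta> (S \<setminus> F) x) (\<Union>F)" for x
  have near: "near x \<in> \<Union>F" "\<And>z. z \<in> \<Union>F \<Longrightarrow> \<delta> (S \<setminus> F) x (near x) \<le> \<delta> (S \<setminus> F) x z" for x
    unfolding near_def using arg_min_if_finite(1)[OF fin False] arg_min_least[OF fin False] by metis+
  have "inj_on near K"
  proof (rule inj_onI, rule ccontr)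
    fix x y assume xy: "x \<in> K" "y \<in> K" "near x = near y" "x \<noteq> y"
    from separated_imp_faulty[OF nonneg sep[OF xy(1,2,4)]] obtain z z'
      where z: "z \<in> \<Union>F" "z' \<in> \<Union>F"
        and less: "\<delta> (S \<setminus> F) x z + \<delta> (S \<setminus> F) y z' < \<delta> (S \<setminus> F) x y"
      by blast
    have "\<delta> (S \<setminus> F) x y \<le> \<delta> (S \<setminus> F) x (near x) + \<delta> (S \<setminus> F) (near x) y"
      by (intro hdist_triangle nonneg_weights_delete nonneg)
    also have "\<dots> = \<delta> (S \<setminus> F) x (near x) + \<delta> (S \<setminus> F) y (near y)"
      using xy(3) by (simp add: hdist_commute)
    also have "\<dots> \<le> \<delta> (S \<setminus> F) x z + \<delta> (S \<setminus> F) y z'"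
      by (intro add_mono near z)
    finally show False
      using less by simp
  qed
  then have "card K \<le> card (\<Union>F)"
    using fin near(1) by (intro card_inj_on_le) auto
  then show ?thesis by simp
qed

section \<open>The greedy walk\<close>

text \<open>The greedy argument on positions \<open>0..l\<close>, with \<open>g\<close> as distance
  and \<open>bad\<close> as separation. \<open>K\<close> collects the starting positions of the
  jumps; since a crossing lies between consecutive jumps, there are \<open>card K\<close> jumps but
  only \<open>card K - 1\<close> crossings.\<close>

lemma greedy_jumps:
  fixes g :: "nat \<Rightarrow> nat \<Rightarrow> ereal" and w :: "nat \<Rightarrow> real" and \<alpha> c :: real
  assumes tri: "\<And>i j k. g i k \<le> g i j + g j k"
    and step: "\<And>i. i < l \<Longrightarrow> g i (Suc i) \<le> ereal (w i + c)"
    and good: "\<And>i j. i \<le> j \<Longrightarrow> j \<le> l \<Longrightarrow> \<not> bad i j \<Longrightarrow> g i j \<le> ereal (sum w {i..<j} + \<alpha>)"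
    and refl: "\<And>i. i \<le> l \<Longrightarrow> \<not> bad i i"
    and "i \<le> l"
  shows "\<exists>K\<subseteq>{i..l}. i \<in> K \<and> (\<forall>a\<in>K. \<forall>b\<in>K. a < b \<longrightarrow> bad a b) \<and>
    g i l \<le> ereal (sum w {i..<l} + real (card K) * \<alpha> + (real (card K) - 1) * c)"
  using \<open>i \<le> l\<close>
proof (induction "l - i" arbitrary: i rule: less_induct)
  case less
  define J where "J = {j. i \<le> j \<and> j \<le> l \<and> \<not> bad i j}"
  define j where "j = Max J"
  have J: "finite J" "i \<in> J"
    using less.prems refl by (auto simp: J_def)
  then have "j \<in> J"
    unfolding j_def by (intro Max_in) auto
  then have ij: "i \<le> j" "j \<le> l" "\<not> bad i j"
    by (auto simp: J_def)
  \<comment> \<open>Positions between \<open>i\<close> and \<open>j\<close> may be bad as well; what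
    counts is that, by maximality of \<open>j\<close>, all later ones are, including every later
    starting position.\<close>
  have bad: "bad i k" if "j < k" "k \<le> l" for k
    using that ij Max_ge[OF J(1), of k] unfolding j_def[symmetric] by (force simp: J_def)
  show ?case
  proof (cases "j = l")
    case True
    then show ?thesis
      using good[OF ij] less.prems by (intro exI[of _ "{i}"]) auto
  next
    case False
    with ij have jl: "j < l" by simp
    have "l - Suc j < l - i" and "Suc j \<le> l"
      using ij jl by auto
    from less.hyps[OF this] obtain K where K: "K \<subseteq> {Suc j..l}" "Suc j \<in> K"
      "\<forall>a\<in>K. \<forall>b\<in>K. a < b \<longrightarrow> bad a b"
      "g (Suc j) l \<le> ereal (sum w {Suc j..<l} + real (card K) * \<alpha> + (real (card K) - 1) * c)"
      by blast
    have fin: "finite K" and "i \<notin> K"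
      using K(1) ij finite_subset by auto
    then have card: "card (insert i K) = Suc (card K)"
      by simp
    \<comment> \<open>One jump to \<open>j\<close>, one crossing to \<open>Suc j\<close>, then the
      induction hypothesis.\<close>
    have "g i l \<le> g i j + (g j (Suc j) + g (Suc j) l)"
      by (meson add_left_mono order_trans tri)
    also have "\<dots> \<le> ereal (sum w {i..<j} + \<alpha>) + (ereal (w j + c) +
        ereal (sum w {Suc j..<l} + real (card K) * \<alpha> + (real (card K) - 1) * c))"
      by (intro add_mono good ij step jl K)
    also have "\<dots> = ereal (sum w {i..<l} + real (card (insert i K)) * \<alpha>
        + (real (card (insert i K)) - 1) * c)"
    proof -
      have "sum w {i..<l} = sum w {i..<j} + (w j + sum w {Suc j..<l})"
        using ij jl by (simp add: sum.atLeastLessThan_concat sum.atLeast_Suc_lessThan[symmetric])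
      then show ?thesis
        unfolding card by (simp add: algebra_simps)
    qed
    finally have "g i l \<le> ereal (sum w {i..<l} + real (card (insert i K)) * \<alpha>
        + (real (card (insert i K)) - 1) * c)" .
    moreover have "insert i K \<subseteq> {i..l}"
      using K(1) less.prems ij by auto
    moreover have "\<forall>a\<in>insert i K. \<forall>b\<in>insert i K. a < b \<longrightarrow> bad a b"
      using K(1,3) ij bad by fastforce
    ultimately show ?thesis by blast
  qed
qed

section \<open>Path segments and the number of faulty vertices\<close>

lemma is_path_hdist_le:
  assumes "is_path H u xs hs v" and "i \<le> j" and "j \<le> length hs"
  shows "\<delta> H (xs ! i) (xs ! j) \<le> ereal (\<Sum>k=i..<j. weight H (hs ! k))"
proof -
  have nth: "xs ! k \<in> verts H" if "k \<le> length hs" for k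
    using assms(1) that by (auto simp: is_path_def subset_iff)
  have "\<exists>gs. walk H (xs ! i) gs (xs ! j) \<and> path_length H gs = (\<Sum>k=i..<j. weight H (hs ! k))"
    using assms(2,3)
  proof (induction j rule: dec_induct)
    case base
    then show ?case
      using walk_Nil[OF nth, of i] by (intro exI[of _ "[]"]) auto
  next
    case (step n)
    then obtain gs where gs: "walk H (xs ! i) gs (xs ! n)"
      "path_length H gs = (\<Sum>k=i..<n. weight H (hs ! k))"
      by auto
    have "walk H (xs ! n) [hs ! n] (xs ! Suc n)"
      using assms(1) step.prems nth by (intro walk_single) (auto simp: is_path_def)
    with gs step show ?case
      by (intro exI[of _ "gs @ [hs ! n]"]) (auto intro: walk_append)
  qed
  then show ?thesis
    using hdist_le by fastforce
qed

lemma card_Union_le_hrank: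
  assumes "hypergraph H" and "F \<subseteq> hedges H"
  shows "finite (\<Union>F)" and "card (\<Union>F) \<le> card F * hrank H"
proof -
  have fin: "finite (hedges H)"
    using assms(1) by (auto simp: hypergraph_def intro: finite_subset)
  show "finite (\<Union>F)"
    using assms by (auto simp: hypergraph_def intro: finite_subset[of _ "verts H"])
  have "card h \<le> hrank H" if "h \<in> F" for h
    unfolding hrank_def using that assms(2) fin by (intro Max_ge) auto
  then have "(\<Sum>h\<in>F. card h) \<le> card F * hrank H"
    using sum_bounded_above[of F card "hrank H"] by simp
  with card_Union_le_sum_card[of F] show "card (\<Union>F) \<le> card F * hrank H"
    by linarith
qed

section \<open>The bound along an arbitrary surviving path\<close>

text \<open>The greedy argument is run with distances in the faulty union and separation in
  \<open>S2\<close>. As \<open>card K\<close> is at most \<open>f * hrank H + 1\<close>, each jump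
  costs an extra \<alpha> and each crossing an extra \<open>c\<close>; one \<alpha> remains outside
  the product.\<close>

lemma hunion_path_bound:
  fixes H S1 S2 :: "'a hypergraph" and \<mu> \<alpha> :: real
  assumes H: "hypergraph H" and nonneg: "nonneg_weights H" and \<mu>: "\<mu> \<ge> 1" and \<alpha>: "\<alpha> \<ge> 0"
    and S1: "eft_mult_hyperspanner f \<mu> H S1" and S2: "additive_hyperspanner \<alpha> H S2"
    and F: "F \<subseteq> hedges H" "card F \<le> f" and path: "is_path (H \<setminus> F) s xs hs t"
  shows "\<delta> ((S1 \<squnion>\<^sub>h S2) \<setminus> F) s t
    \<le> ereal (path_length H hs + real f * real (hrank H) * (\<alpha> + (\<mu> - 1) * max_weight H hs) + \<alpha>)"
proof -
  let ?S = "(S1 \<squnion>\<^sub>h S2) \<setminus> F"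
  define c where "c = (\<mu> - 1) * max_weight H hs"
  define w where "w k = weight H (hs ! k)" for k
  have sub1: "sub_hypergraph S1 H" and sub2: "sub_hypergraph S2 H"
    using S1 S2 by (auto simp: eft_mult_hyperspanner_def additive_hyperspanner_def)
  have "sub_hypergraph (S1 \<squnion>\<^sub>h S2) H"
    using sub1 sub2 by (auto simp: sub_hypergraph_def)
  then have nnS: "nonneg_weights ?S"
    by (intro nonneg_weights_delete nonneg_weights_sub[OF nonneg])
  have nn2: "nonneg_weights S2"
    by (rule nonneg_weights_sub[OF nonneg sub2])
  have le1: "\<delta> ?S x y \<le> \<delta> (S1 \<setminus> F) x y" and le2: "\<delta> ?S x y \<le> \<delta> (S2 \<setminus> F) x y"
    and leF: "\<delta> H x y \<le> \<delta> (H \<setminus> F) x y" for x y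
    using sub1 sub2 by (intro hdist_antimono; force simp: sub_hypergraph_def)+
  have nth: "xs ! k \<in> verts H" if "k \<le> length hs" for k
    using path that by (auto simp: is_path_def subset_iff)
  have w_le: "w k \<le> max_weight H hs" if "k < length hs" for k
    using that by (auto simp: w_def max_weight_def intro!: Max_ge)
  have "0 \<le> max_weight H hs"
    by (auto simp: max_weight_def intro!: Max_ge)
  then have c: "0 \<le> c"
    using \<mu> by (simp add: c_def)
  have "\<exists>K\<subseteq>{0..length hs}. 0 \<in> K \<and>
      (\<forall>a\<in>K. \<forall>b\<in>K. a < b \<longrightarrow> separated S2 F (xs ! a) (xs ! b)) \<and>
      \<delta> ?S (xs ! 0) (xs ! length hs) \<le>
        ereal (sum w {0..<length hs} + real (card K) * \<alpha> + (real (card K) - 1) * c)"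
  proof (rule greedy_jumps)
    show "\<delta> ?S (xs ! i) (xs ! k) \<le> \<delta> ?S (xs ! i) (xs ! j) + \<delta> ?S (xs ! j) (xs ! k)" for i j k
      by (rule hdist_triangle[OF nnS])
  next
    fix i assume i: "i < length hs"
    \<comment> \<open>Crossing: the hyperedge survives in \<open>H \<setminus> F\<close>, so the
      fault-tolerant guarantee of \<open>S1\<close> applies to its two vertices.\<close>
    have "\<delta> ?S (xs ! i) (xs ! Suc i) \<le> \<delta> (S1 \<setminus> F) (xs ! i) (xs ! Suc i)"
      by (rule le1)
    also have "\<dots> \<le> ereal \<mu> * \<delta> (H \<setminus> F) (xs ! i) (xs ! Suc i)"
      using S1 F nth i by (auto simp: eft_mult_hyperspanner_def)
    also have "\<dots> \<le> ereal \<mu> * ereal (w i)"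
      using is_path_hdist_le[OF path, of i "Suc i"] i \<mu>
      by (intro ereal_mult_left_mono) (auto simp: w_def)
    \<comment> \<open>The excess of \<mu> \<open>w i\<close> over \<open>w i\<close> is (\<mu> - 1)
      \<open>w i\<close>, at most \<open>c\<close>.\<close>
    also have "\<dots> \<le> ereal (w i + c)"
      using mult_left_mono[OF w_le[OF i], of "\<mu> - 1"] \<mu> by (simp add: c_def algebra_simps)
    finally show "\<delta> ?S (xs ! i) (xs ! Suc i) \<le> ereal (w i + c)" .
  next
    fix i j assume ij: "i \<le> j" "j \<le> length hs" "\<not> separated S2 F (xs ! i) (xs ! j)"
    \<comment> \<open>Jump: for a pair that is not separated, the faults do not increase the
      distance in \<open>S2\<close>, so its fault-free guarantee can be used.\<close>
    have "\<delta> ?S (xs ! i) (xs ! j) \<le> \<delta> S2 (xs ! i) (xs ! j)"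
      using order_trans[OF le2] ij(3) by (simp add: separated_def not_less)
    also have "\<dots> \<le> \<delta> H (xs ! i) (xs ! j) + ereal \<alpha>"
      using S2 nth ij by (auto simp: additive_hyperspanner_def)
    also have "\<dots> \<le> ereal (sum w {i..<j}) + ereal \<alpha>"
      using order_trans[OF leF is_path_hdist_le[OF path ij(1,2)]]
      by (intro add_right_mono) (simp add: w_def)
    finally show "\<delta> ?S (xs ! i) (xs ! j) \<le> ereal (sum w {i..<j} + \<alpha>)"
      by simp
  next
    show "\<not> separated S2 F (xs ! i) (xs ! i)" if "i \<le> length hs" for i
      using not_separated_refl[OF nn2] nth[OF that] sub2 by (simp add: sub_hypergraph_def)
  qed simp
  then obtain K where K: "K \<subseteq> {0..length hs}"
      "\<forall>a\<in>K. \<forall>b\<in>K. a < b \<longrightarrow> separated S2 F (xs ! a) (xs ! b)"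
    and bound: "\<delta> ?S (xs ! 0) (xs ! length hs) \<le>
        ereal (sum w {0..<length hs} + real (card K) * \<alpha> + (real (card K) - 1) * c)"
    by blast
  have sep: "separated S2 F (xs ! a) (xs ! b)" if "a \<in> K" "b \<in> K" "a \<noteq> b" for a b
    using K(2) that separated_commute by (metis linorder_neqE_nat)
  \<comment> \<open>\<open>K\<close> consists of positions, and a path may repeat vertices.
    Positions in \<open>K\<close> still carry distinct vertices, as no vertex is separated from
    itself.\<close>
  have "inj_on ((!) xs) K"
  proof (rule inj_onI, rule ccontr)
    fix a b assume ab: "a \<in> K" "b \<in> K" "xs ! a = xs ! b" "a \<noteq> b"
    have "xs ! b \<in> verts S2"
      using K(1) ab(2) nth sub2 by (auto simp: sub_hypergraph_def subset_iff)
    with sep[OF ab(1,2,4)] ab(3) not_separated_refl[OF nn2] show False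
      by simp
  qed
  then have "card K = card ((!) xs ` K)"
    by (simp add: card_image)
  also have "\<dots> \<le> Suc (card (\<Union>F))"
    using sep by (intro card_separated_le[OF nn2 card_Union_le_hrank(1)[OF H F(1)]]) auto
  also have "\<dots> \<le> Suc (f * hrank H)"
    using card_Union_le_hrank(2)[OF H F(1)] mult_le_mono1[OF F(2), of "hrank H"] by linarith
  finally have "real (card K) \<le> real (Suc (f * hrank H))"
    by (simp only: of_nat_le_iff)
  then have card: "real (card K) \<le> real f * real (hrank H) + 1"
    by simp
  have "sum w {0..<length hs} = path_length H hs"
    by (simp add: path_length_def w_def sum_list_sum_nth)
  moreover have "real (card K) * \<alpha> \<le> (real f * real (hrank H) + 1) * \<alpha>"
    using card \<alpha> by (rule mult_right_mono)
  \<comment> \<open>The last jump is followed by no crossing, which cancels the extra 1 in the bound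
    on \<open>card K\<close>.\<close>
  moreover have "(real (card K) - 1) * c \<le> real f * real (hrank H) * c"
    using card c by (intro mult_right_mono) auto
  ultimately have "sum w {0..<length hs} + real (card K) * \<alpha> + (real (card K) - 1) * c
      \<le> path_length H hs + real f * real (hrank H) * (\<alpha> + c) + \<alpha>"
    by (simp add: algebra_simps)
  with bound have "\<delta> ?S (xs ! 0) (xs ! length hs)
      \<le> ereal (path_length H hs + real f * real (hrank H) * (\<alpha> + c) + \<alpha>)"
    by (meson ereal_less_eq(3) order_trans)
  with path show ?thesis
    by (simp add: is_path_def c_def)
qed

theorem theorem3:
  fixes H S1 S2 :: "'a hypergraph" and r f :: nat and \<mu> \<alpha> :: real
  assumes "hypergraph H" and "nonneg_weights H" and "hrank H = r"
    and "f \<ge> 1" and "\<mu> \<ge> 1" and "\<alpha> \<ge> 0"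
    and "eft_mult_hyperspanner f \<mu> H S1"
    and "additive_hyperspanner \<alpha> H S2"
  shows "sub_hypergraph (S1 \<squnion>\<^sub>h S2) H \<and>
    hsize (S1 \<squnion>\<^sub>h S2) = card (hedges S1 \<union> hedges S2) \<and>
    (\<forall>s\<in>verts H. \<forall>t\<in>verts H. \<forall>F. F \<subseteq> hedges H \<and> card F \<le> f \<longrightarrow>
       (\<forall>xs hs. is_shortest_path (H \<setminus> F) s xs hs t \<longrightarrow>
          \<delta> ((S1 \<squnion>\<^sub>h S2) \<setminus> F) s t
            \<le> \<delta> (H \<setminus> F) s t
               + ereal (real f * real r * (2 * \<alpha> + (\<mu> - 1) * max_weight (H \<setminus> F) hs) + \<alpha>)))"
proof (intro conjI ballI allI impI)
  have sub: "sub_hypergraph S1 H" "sub_hypergraph S2 H"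
    using assms(7,8) by (auto simp: eft_mult_hyperspanner_def additive_hyperspanner_def)
  then show "sub_hypergraph (S1 \<squnion>\<^sub>h S2) H"
    by (auto simp: sub_hypergraph_def)
  show "hsize (S1 \<squnion>\<^sub>h S2) = card (hedges S1 \<union> hedges S2)"
    by (simp add: hsize_def)
next
  fix s t F xs hs
  assume F: "F \<subseteq> hedges H \<and> card F \<le> f" and sp: "is_shortest_path (H \<setminus> F) s xs hs t"
  have maxw: "max_weight (H \<setminus> F) hs = max_weight H hs"
    by (simp add: max_weight_def)
  have "\<delta> ((S1 \<squnion>\<^sub>h S2) \<setminus> F) s t
      \<le> ereal (path_length H hs + real f * real r * (\<alpha> + (\<mu> - 1) * max_weight H hs) + \<alpha>)"
    using hunion_path_bound[OF assms(1,2,5,6,7,8)] F sp assms(3) by (auto simp: is_shortest_path_def)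
  \<comment> \<open>Passing from \<alpha> to \<open>2 * \<alpha>\<close> only enlarges the bound,
    since \<alpha> is nonnegative.\<close>
  also have "\<dots> \<le> ereal (path_length H hs + (real f * real r *
      (2 * \<alpha> + (\<mu> - 1) * max_weight H hs) + \<alpha>))"
    using assms(6) by (auto intro!: mult_left_mono)
  also have "\<dots> = \<delta> (H \<setminus> F) s t
      + ereal (real f * real r * (2 * \<alpha> + (\<mu> - 1) * max_weight (H \<setminus> F) hs) + \<alpha>)"
    using sp unfolding maxw by (simp add: is_shortest_path_def flip: plus_ereal.simps(1))
  finally show "\<delta> ((S1 \<squnion>\<^sub>h S2) \<setminus> F) s t \<le> \<delta> (H \<setminus> F) s t
      + ereal (real f * real r * (2 * \<alpha> + (\<mu> - 1) * max_weight (H \<setminus> F) hs) + \<alpha>)" .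
qed

end
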